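(* Let $\mathbf f^{\mathrm M}:\Omega^{\mathrm M}\subseteq\mathbb R^{n_m}\to\mathbb R^{n_m}$ be the vector function of nonlinear pump head terms, with components $f^{\mathrm M}_i(\mathbf u)=-h_i^{\mathrm s}s_i^2+r_i\,q_i^{\nu_i}s_i^{2-\nu_i}$ for $\mathbf u=(q_1,\dots,q_{n_m})\in\Omega^{\mathrm M}=[q_1^{\min},q_1^{\max}]\times\dots\times[q_{n_m}^{\min},q_{n_m}^{\max}]$, where for every $i$: $q_i^{\min}>0$, and $r_i>0$, $s_i\in(0,1]$, $1\le\nu_i\le 3$ and $h_i^{\mathrm s}>0$ are fixed. Then $\mathbf f^{\mathrm M}$ is Lipschitz continuous on $\Omega^{\mathrm M}$ with constant $$K^{\mathrm M}=\max_i\ \nu_i\,r_i\,(q_i^{\max})^{\nu_i-1}\,s_i^{2-\nu_i}.$$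
   Context: A function $\mathbf f:\Omega\subseteq\mathbb R^n\to\mathbb R^m$ is Lipschitz continuous on $\Omega$ with constant $K\ge 0$ if $\|\mathbf f(\mathbf z_1)-\mathbf f(\mathbf z_2)\|_2\le K\|\mathbf z_1-\mathbf z_2\|_2$ for all $\mathbf z_1,\mathbf z_2\in\Omega$, where $\|\cdot\|_2$ is the Euclidean norm. In a water distribution network with $n_m\ge 1$ pumps, $q_i$ is the flow rate through pump $i$, confined to a compact interval $[q_i^{\min},q_i^{\max}]$; $s_i$ is the (fixed) relative pump speed, $h_i^{\mathrm s}$ the shutoff head, and $r_i,\nu_i$ the pump-curve coefficients. *)

theory Defs
  imports "HOL-Analysis.Analysis"
begin

(* The pumps are indexed by a finite type 'n, so n_m = CARD('n) >= 1. *)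

definition pump_domain :: "('n \<Rightarrow> real) \<Rightarrow> ('n \<Rightarrow> real) \<Rightarrow> (real ^ 'n::finite) set" where
  "pump_domain qmin qmax = {u. \<forall>i. u $ i \<in> {qmin i..qmax i}}"

definition pump_head ::
  "('n \<Rightarrow> real) \<Rightarrow> ('n \<Rightarrow> real) \<Rightarrow> ('n \<Rightarrow> real) \<Rightarrow> ('n \<Rightarrow> real) \<Rightarrow> real ^ 'n \<Rightarrow> real ^ 'n::finite"
where
  "pump_head h s r \<nu> u =
     (\<chi> i. - h i * (s i)\<^sup>2 + r i * (u $ i) powr \<nu> i * s i powr (2 - \<nu> i))"

definition pump_lipschitz_const ::
  "('n::finite \<Rightarrow> real) \<Rightarrow> ('n \<Rightarrow> real) \<Rightarrow> ('n \<Rightarrow> real) \<Rightarrow> ('n \<Rightarrow> real) \<Rightarrow> real" where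
  "pump_lipschitz_const s r \<nu> qmax =
     (MAX i. \<nu> i * r i * qmax i powr (\<nu> i - 1) * s i powr (2 - \<nu> i))"

end

theory Submission
  imports Defs
begin

text \<open>
  Each component of the pump head depends on a single coordinate of \<open>u\<close>, namely on its own flow.
  The Jacobian is therefore diagonal, and its spectral norm is the largest absolute diagonal
  entry. The entry \<open>\<nu> i * r i * q powr (\<nu> i - 1) * s i powr (2 - \<nu> i)\<close> is nondecreasing in the
  flow \<open>q\<close> because \<open>\<nu> i \<ge> 1\<close>, so it is largest at \<open>q = qmax i\<close>.

  The proof does this without the Jacobian: the mean value theorem for \<open>x powr p\<close> bounds every
  component separately (\<open>powr_diff_le\<close>), and a diagonal map is Lipschitz for the Euclidean norm
  with any constant that works for all of its components (\<open>lipschitz_on_componentwise\<close>).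
\<close>

text \<open>
  Mean value theorem: the derivative \<open>p * x powr (p - 1)\<close> is nonnegative, and for \<open>p \<ge> 1\<close> it is
  largest at the right end \<open>b\<close> of the interval.
\<close>
lemma powr_diff_le:
  fixes x y b p :: real
  assumes "1 \<le> p" "x \<in> {0<..b}" "y \<in> {0<..b}"
  shows "\<bar>x powr p - y powr p\<bar> \<le> p * b powr (p - 1) * \<bar>x - y\<bar>"
proof -
  have "norm (x powr p - y powr p) \<le> p * b powr (p - 1) * norm (x - y)"
  proof (rule field_differentiable_bound)
    show "convex {0<..b}" by simp
  next
    fix z assume z: "z \<in> {0<..b}"
    then show "((\<lambda>z. z powr p) has_field_derivative p * z powr (p - 1)) (at z within {0<..b})"
      by (auto intro!: derivative_eq_intros)
    show "norm (p * z powr (p - 1)) \<le> p * b powr (p - 1)"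
      using z assms(1) by (auto simp: abs_mult intro!: mult_left_mono powr_mono2)
  qed (use assms in auto)
  then show ?thesis by simp
qed

text \<open>
  The bound on the components makes every component of \<open>f u - f v\<close> at most as large as that of
  \<open>K *\<^sub>R (u - v)\<close>, and the Euclidean norm is monotone in the absolute values of the components.
  No factor for the dimension appears, since the \<open>i\<close>-th component is bounded by the \<open>i\<close>-th
  coordinate alone.
\<close>
lemma lipschitz_on_componentwise:
  fixes f :: "real ^ 'n::finite \<Rightarrow> real ^ 'n"
  assumes "0 \<le> K"
    and "\<And>u v i. u \<in> S \<Longrightarrow> v \<in> S \<Longrightarrow> \<bar>f u $ i - f v $ i\<bar> \<le> K * \<bar>u $ i - v $ i\<bar>"
  shows "K-lipschitz_on S f"
proof (rule lipschitz_onI)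
  fix u v assume uv: "u \<in> S" "v \<in> S"
  have "norm (f u - f v) \<le> norm (K *\<^sub>R (u - v))"
    by (rule norm_le_componentwise_cart) (use assms uv in \<open>simp add: abs_mult\<close>)
  then show "dist (f u) (f v) \<le> K * dist u v"
    using assms(1) by (simp add: dist_norm)
qed (fact assms(1))

theorem proposition2:
  fixes qmin qmax h s r \<nu> :: "'n::finite \<Rightarrow> real"
  assumes "\<And>i. qmin i > 0"
    and "\<And>i. r i > 0"
    and "\<And>i. s i \<in> {0<..1}"
    and "\<And>i. 1 \<le> \<nu> i \<and> \<nu> i \<le> 3"
    and "\<And>i. h i > 0"
  shows "(pump_lipschitz_const s r \<nu> qmax)-lipschitz_on (pump_domain qmin qmax)
           (pump_head h s r \<nu>)"
proof (rule lipschitz_on_componentwise)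
  let ?k = "\<lambda>i. \<nu> i * r i * qmax i powr (\<nu> i - 1) * s i powr (2 - \<nu> i)"
  have k_le: "?k i \<le> pump_lipschitz_const s r \<nu> qmax" for i
    unfolding pump_lipschitz_const_def by (rule Max_ge) auto
  have k_nonneg: "0 \<le> ?k i" for i
    using assms(2,4)[of i] by (intro mult_nonneg_nonneg) auto
  show "0 \<le> pump_lipschitz_const s r \<nu> qmax"
    using k_nonneg k_le by (rule order_trans)
  fix u v i
  assume "u \<in> pump_domain qmin qmax" "v \<in> pump_domain qmin qmax"
  then have "u $ i \<in> {qmin i..qmax i}" "v $ i \<in> {qmin i..qmax i}"
    by (auto simp: pump_domain_def)
  then have flows: "u $ i \<in> {0<..qmax i}" "v $ i \<in> {0<..qmax i}"
    using assms(1)[of i] by auto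
  let ?c = "r i * s i powr (2 - \<nu> i)"
  have c_nonneg: "0 \<le> ?c"
    using assms(2)[of i] by simp
  have "pump_head h s r \<nu> u $ i - pump_head h s r \<nu> v $ i
      = ?c * ((u $ i) powr \<nu> i - (v $ i) powr \<nu> i)"
    by (simp add: pump_head_def algebra_simps)
  then have "\<bar>pump_head h s r \<nu> u $ i - pump_head h s r \<nu> v $ i\<bar>
      = ?c * \<bar>(u $ i) powr \<nu> i - (v $ i) powr \<nu> i\<bar>"
    by (simp only: abs_mult [of ?c] abs_of_nonneg [OF c_nonneg])
  also have "\<dots> \<le> ?c * (\<nu> i * qmax i powr (\<nu> i - 1) * \<bar>u $ i - v $ i\<bar>)"
    using assms(4) flows c_nonneg by (intro mult_left_mono powr_diff_le) auto
  also have "\<dots> = ?k i * \<bar>u $ i - v $ i\<bar>"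
    by (simp add: mult_ac)
  also have "\<dots> \<le> pump_lipschitz_const s r \<nu> qmax * \<bar>u $ i - v $ i\<bar>"
    using k_le by (rule mult_right_mono) simp
  finally show "\<bar>pump_head h s r \<nu> u $ i - pump_head h s r \<nu> v $ i\<bar>
      \<le> pump_lipschitz_const s r \<nu> qmax * \<bar>u $ i - v $ i\<bar>" .
qed

end
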